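(* Let $n\ge 1$ and let $T^*(n,\mathbb{R})$ be the group of upper triangular $n\times n$ real matrices with positive diagonal entries. Then there exists $k$ such that $T^*(n,\mathbb{R})$ admits an essentially free (orientation-preserving) affine action on $\mathbb{R}^k$, where $\mathbb{R}^k$ carries the lexicographic order.
   Context: An ordered abelian group $\Lambda$ is an additively written abelian group with a translation-invariant linear order; $\mathrm{Aut}^+(\Lambda)$ is the group of order-preserving group automorphisms of $\Lambda$. $\Lambda$ is viewed as a $\Lambda$-metric space (a "linear $\Lambda$-tree") via $d(x,y)=|x-y|=\max\{x-y,y-x\}$. Given a group $G$ and a homomorphism $\alpha:G\to\mathrm{Aut}^+(\Lambda)$, $g\mapsto\alpha_g$, an $\alpha$-affine action of $G$ on $\Lambda$ is an action of $G$ on the set $\Lambda$ with $d(gx,gy)=\alpha_g d(x,y)$ for all $x,y\in\Lambda$, $g\in G$. An affine action is an $\alpha$-affine action for some $\alpha$. All affine actions on $\Lambda$ are assumed to be orientation-preserving, i.e. $x\le y\Rightarrow gx\le gy$ (equivalently, each $g$ acts as $x\mapsto \alpha_g x+\nu_g$ for some $\nu_g\in\Lambda$). An orientation-preserving affine automorphism $g$ of $\Lambda$ is hyperbolic if it fixes no point of $\Lambda$, and rigid if no segment $[\lambda_1,\lambda_2]=\{\mu:\lambda_1\le\mu\le\lambda_2\}$ is mapped properly into itself by $g$ or $g^{-1}$; equivalently, if $g^{\epsilon}\lambda>\lambda$ for some $\lambda\in\Lambda$ and $\epsilon=\pm1$, then $g^{\epsilon}\lambda'>\lambda'$ for all $\lambda'\in\Lambda$.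 An affine action of $G$ on $\Lambda$ is essentially free if every non-trivial $g\in G$ acts as a rigid and hyperbolic automorphism. *)

theory Defs
  imports "HOL-Algebra.Group_Action" "HOL-Algebra.Bij" "Jordan_Normal_Form.Matrix" "HOL.Real"
begin

text \<open>Ordered abelian groups need an explicit carrier here, since the dimension of the
  lexicographically ordered space is existentially quantified. As with every \<^const>\<open>comm_group\<close>,
  the group operation is denoted multiplicatively: \<open>x \<otimes> inv y\<close> is the difference of \<open>x\<close>
  and \<open>y\<close>. The relation is only meaningful on the carrier.\<close>

record 'a ordered_group = "'a monoid" +
  gle :: "'a \<Rightarrow> 'a \<Rightarrow> bool" (infixl "\<preceq>\<index>" 50)

locale ordered_abelian_group = comm_group \<Lambda> for \<Lambda> (structure) +
  assumes linear_order:
    "linear_order_on (carrier \<Lambda>) {(x, y). x \<in> carrier \<Lambda> \<and> y \<in> carrier \<Lambda> \<and> x \<preceq> y}"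
  and translation_invariant:
    "\<lbrakk>x \<in> carrier \<Lambda>; y \<in> carrier \<Lambda>; z \<in> carrier \<Lambda>; x \<preceq> y\<rbrakk> \<Longrightarrow> x \<otimes> z \<preceq> y \<otimes> z"

definition order_preserving :: "('a, 'm) ordered_group_scheme \<Rightarrow> ('a \<Rightarrow> 'a) \<Rightarrow> bool" where
  "order_preserving \<Lambda> f \<longleftrightarrow>
    (\<forall>x\<in>carrier \<Lambda>. \<forall>y\<in>carrier \<Lambda>. x \<preceq>\<^bsub>\<Lambda>\<^esub> y \<longrightarrow> f x \<preceq>\<^bsub>\<Lambda>\<^esub> f y)"

definition Aut_plus :: "('a, 'm) ordered_group_scheme \<Rightarrow> ('a \<Rightarrow> 'a) monoid" where
  "Aut_plus \<Lambda> = AutoGroup \<Lambda> \<lparr>carrier := {f \<in> auto \<Lambda>. order_preserving \<Lambda> f}\<rparr>"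

definition gmax :: "('a, 'm) ordered_group_scheme \<Rightarrow> 'a \<Rightarrow> 'a \<Rightarrow> 'a" where
  "gmax \<Lambda> x y = (if x \<preceq>\<^bsub>\<Lambda>\<^esub> y then y else x)"

definition gdist :: "('a, 'm) ordered_group_scheme \<Rightarrow> 'a \<Rightarrow> 'a \<Rightarrow> 'a" where
  "gdist \<Lambda> x y = gmax \<Lambda> (x \<otimes>\<^bsub>\<Lambda>\<^esub> inv\<^bsub>\<Lambda>\<^esub> y) (y \<otimes>\<^bsub>\<Lambda>\<^esub> inv\<^bsub>\<Lambda>\<^esub> x)"

definition segment :: "('a, 'm) ordered_group_scheme \<Rightarrow> 'a \<Rightarrow> 'a \<Rightarrow> 'a set" where
  "segment \<Lambda> a b = {x \<in> carrier \<Lambda>. a \<preceq>\<^bsub>\<Lambda>\<^esub> x \<and> x \<preceq>\<^bsub>\<Lambda>\<^esub> b}"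

definition alpha_affine_action ::
  "('a, 'm) ordered_group_scheme \<Rightarrow> ('g, 'n) monoid_scheme \<Rightarrow> ('g \<Rightarrow> 'a \<Rightarrow> 'a) \<Rightarrow>
    ('g \<Rightarrow> 'a \<Rightarrow> 'a) \<Rightarrow> bool" where
  "alpha_affine_action \<Lambda> G \<alpha> \<phi> \<longleftrightarrow>
    \<alpha> \<in> hom G (Aut_plus \<Lambda>) \<and> group_action G (carrier \<Lambda>) \<phi> \<and>
    (\<forall>g\<in>carrier G. \<forall>x\<in>carrier \<Lambda>. \<forall>y\<in>carrier \<Lambda>.
      gdist \<Lambda> (\<phi> g x) (\<phi> g y) = \<alpha> g (gdist \<Lambda> x y))"

text \<open>Affine actions are by convention orientation-preserving.\<close>

definition affine_action ::
  "('a, 'm) ordered_group_scheme \<Rightarrow> ('g, 'n) monoid_scheme \<Rightarrow> ('g \<Rightarrow> 'a \<Rightarrow> 'a) \<Rightarrow> bool" where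
  "affine_action \<Lambda> G \<phi> \<longleftrightarrow>
    ordered_abelian_group \<Lambda> \<and> (\<exists>\<alpha>. alpha_affine_action \<Lambda> G \<alpha> \<phi>) \<and>
    (\<forall>g\<in>carrier G. order_preserving \<Lambda> (\<phi> g))"

definition hyperbolic :: "('a, 'm) ordered_group_scheme \<Rightarrow> ('a \<Rightarrow> 'a) \<Rightarrow> bool" where
  "hyperbolic \<Lambda> f \<longleftrightarrow> (\<forall>x\<in>carrier \<Lambda>. f x \<noteq> x)"

definition rigid :: "('a, 'm) ordered_group_scheme \<Rightarrow> ('a \<Rightarrow> 'a) \<Rightarrow> bool" where
  "rigid \<Lambda> f \<longleftrightarrow>
    (\<forall>a\<in>carrier \<Lambda>. \<forall>b\<in>carrier \<Lambda>.
      \<not> f ` segment \<Lambda> a b \<subset> segment \<Lambda> a b \<and>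
      \<not> inv_into (carrier \<Lambda>) f ` segment \<Lambda> a b \<subset> segment \<Lambda> a b)"

definition essentially_free_affine_action ::
  "('a, 'm) ordered_group_scheme \<Rightarrow> ('g, 'n) monoid_scheme \<Rightarrow> ('g \<Rightarrow> 'a \<Rightarrow> 'a) \<Rightarrow> bool" where
  "essentially_free_affine_action \<Lambda> G \<phi> \<longleftrightarrow>
    affine_action \<Lambda> G \<phi> \<and>
    (\<forall>g\<in>carrier G. g \<noteq> \<one>\<^bsub>G\<^esub> \<longrightarrow> rigid \<Lambda> (\<phi> g) \<and> hyperbolic \<Lambda> (\<phi> g))"

text \<open>The lexicographic order, with coordinate 0 the most significant. The order \<open>\<le>\<close> that
  the library provides on vectors is the componentwise one.\<close>

definition lex_le :: "nat \<Rightarrow> real vec \<Rightarrow> real vec \<Rightarrow> bool" where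
  "lex_le k u v \<longleftrightarrow> u = v \<or> (\<exists>i<k. (\<forall>j<i. u $ j = v $ j) \<and> u $ i < v $ i)"

definition lex_group :: "nat \<Rightarrow> real vec ordered_group" where
  "lex_group k = monoid.extend (monoid_vec TYPE(real) k) \<lparr>gle = lex_le k\<rparr>"

definition pos_upper_triangular_group :: "nat \<Rightarrow> real mat monoid" where
  "pos_upper_triangular_group n =
    \<lparr>carrier = {A \<in> carrier_mat n n. upper_triangular A \<and> (\<forall>i<n. A $$ (i, i) > 0)},
     monoid.mult = (*), one = 1\<^sub>m n\<rparr>"

lemma lex_group_simps [simp]:
  "carrier (lex_group k) = carrier_vec k" "monoid.mult (lex_group k) = (+)"
  "one (lex_group k) = 0\<^sub>v k" "gle (lex_group k) = lex_le k"
  by (simp_all add: lex_group_def monoid.defs monoid_vec_def)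

lemma lex_le_trans: "lex_le k u v \<Longrightarrow> lex_le k v w \<Longrightarrow> lex_le k u w"
proof -
  assume a: "lex_le k u v" "lex_le k v w"
  show ?thesis
  proof (cases "u = v \<or> v = w")
    case False
    then obtain i j where i: "i < k" "\<forall>l<i. u $ l = v $ l" "u $ i < v $ i"
      and j: "j < k" "\<forall>l<j. v $ l = w $ l" "v $ j < w $ j"
      using a by (auto simp: lex_le_def)
    have "\<forall>l<min i j. u $ l = w $ l" using i j by simp
    moreover have "u $ min i j < w $ min i j"
      using i j by (cases i j rule: linorder_cases) (auto simp: min_def)
    ultimately show ?thesis
      using i(1) j(1) unfolding lex_le_def by (metis min_def)
  qed (use a in auto)
qed

lemma lex_le_antisym: "lex_le k u v \<Longrightarrow> lex_le k v u \<Longrightarrow> u = v"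
  unfolding lex_le_def by (metis less_asym linorder_neqE_nat order_less_irrefl)

lemma lex_le_total:
  assumes "u \<in> carrier_vec k" "v \<in> carrier_vec k"
  shows "lex_le k u v \<or> lex_le k v u"
proof (cases "u = v")
  case False
  then have ex: "\<exists>i. i < k \<and> u $ i \<noteq> v $ i"
    using assms by (metis carrier_vecD eq_vecI)
  define i where "i = (LEAST i. i < k \<and> u $ i \<noteq> v $ i)"
  have i: "i < k" "u $ i \<noteq> v $ i" using LeastI_ex[OF ex] by (auto simp: i_def)
  have "\<forall>j<i. u $ j = v $ j"
    using not_less_Least i(1) unfolding i_def by (metis (mono_tags, lifting) less_trans)
  with i show ?thesis unfolding lex_le_def by (metis linorder_neqE_linordered_idom)
qed (simp add: lex_le_def)

lemma ordered_abelian_group_lex_group: "ordered_abelian_group (lex_group k)"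
proof -
  have cg: "comm_group (lex_group k)"
    by (unfold_locales; use add_inv_exists_vec in
        \<open>auto simp: Units_def ac_simps\<close>)
  let ?R = "{(x, y). x \<in> carrier_vec k \<and> y \<in> carrier_vec k \<and> lex_le k x y}"
  have refl: "refl_on (carrier_vec k) ?R"
    by (simp add: refl_on_def lex_le_def)
  have trans: "trans ?R"
    by (rule transI) (auto intro: lex_le_trans)
  have antisym: "antisym ?R"
    by (rule antisymI) (auto intro: lex_le_antisym)
  have total: "total_on (carrier_vec k) ?R"
    using lex_le_total by (auto simp: total_on_def)
  have linear: "linear_order_on (carrier_vec k) ?R"
    using refl trans antisym total by (auto simp: order_on_defs)
  have add: "lex_le k (x + z) (y + z)"
    if xyz: "x \<in> carrier_vec k" "y \<in> carrier_vec k" "z \<in> carrier_vec k" "lex_le k x y" for x y z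
  proof (cases "x = y")
    case False
    then obtain i where i: "i < k" "\<forall>j<i. x $ j = y $ j" "x $ i < y $ i"
      using xyz(4) by (auto simp: lex_le_def)
    have "\<forall>j<i. (x + z) $ j = (y + z) $ j" "(x + z) $ i < (y + z) $ i"
      using i xyz(1-3) by auto
    with i(1) show ?thesis unfolding lex_le_def by blast
  qed (simp add: lex_le_def)
  show ?thesis
    by (intro ordered_abelian_group.intro ordered_abelian_group_axioms.intro cg)
      (use linear add in simp_all)
qed

end

theory Submission
  imports Defs Complex_Main "Jordan_Normal_Form.Determinant"
begin

text \<open>Let \<open>T\<close> be the group of upper triangular matrices with positive diagonal, \<open>D\<close> its diagonal
subgroup and \<open>U\<close> its unitriangular subgroup, so that \<open>T = U D\<close>. The group \<open>T\<close> acts on the coset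
space \<open>T / D\<close>, which is identified with \<open>U\<close>; since the diagonal of \<open>g u\<close> is that of \<open>g\<close>, the
action reads \<open>u \<mapsto> g u diag(g)\<^sup>-\<^sup>1\<close>. It also acts on \<open>\<real>\<^sup>n\<close>, through \<open>T / U\<close>, by
translating the coordinate \<open>i\<close> by \<open>ln g\<^sub>i\<^sub>i\<close>. The action used here is the product of the two.

The entry \<open>(i, j)\<close>, \<open>i < j\<close>, of \<open>g u diag(g)\<^sup>-\<^sup>1\<close> is
\<open>(\<Sum>l=i..<j. g\<^sub>i\<^sub>l u\<^sub>l\<^sub>j) / g\<^sub>j\<^sub>j + g\<^sub>i\<^sub>j / g\<^sub>j\<^sub>j\<close>,
which is affine in the entries of \<open>u\<close> above the diagonal. Let the \<open>\<real>\<^sup>n\<close> part come first in the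
lexicographic order, followed by the entries of \<open>u\<close> sorted by their distance \<open>j - i\<close> from the
diagonal. The sum involves the entry \<open>u\<^sub>i\<^sub>j\<close> with the positive coefficient \<open>g\<^sub>i\<^sub>i / g\<^sub>j\<^sub>j\<close>, and
otherwise only entries closer to the diagonal. So the linear part of \<open>g\<close> is triangular with
positive diagonal with respect to this order of the coordinates, hence it is order-preserving
(\<open>act_order_preserving\<close>).

For essential freeness, consider the first coordinate at which the translation part of \<open>g \<noteq> 1\<close>
is non-zero. The vanishing of the earlier translation coordinates says that the corresponding
entries of \<open>g\<close> are those of the identity matrix, and these are the entries which govern the
linear part up to and including that coordinate
(\<open>act_index_if_translation_part_zero_below\<close>). Thus \<open>g\<close> fixes all earlier coordinates and shifts
this one by a non-zero constant, the same for all points. All points are moved in the same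
direction, which is rigidity and hyperbolicity
(\<open>rigid_hyperbolic_if_leading_coordinate_shifted\<close>).\<close>

section \<open>Affine actions on ordered abelian groups\<close>

lemma (in ordered_abelian_group) gle_refl: "x \<in> carrier \<Lambda> \<Longrightarrow> x \<preceq> x"
  using linear_order by (auto simp: order_on_defs refl_on_def)

lemma (in ordered_abelian_group) gle_trans:
  "\<lbrakk>x \<preceq> y; y \<preceq> z; x \<in> carrier \<Lambda>; y \<in> carrier \<Lambda>; z \<in> carrier \<Lambda>\<rbrakk> \<Longrightarrow> x \<preceq> z"
  using linear_order by (fastforce simp: order_on_defs dest: transD)

lemma (in ordered_abelian_group) gle_antisym:
  "\<lbrakk>x \<preceq> y; y \<preceq> x; x \<in> carrier \<Lambda>; y \<in> carrier \<Lambda>\<rbrakk> \<Longrightarrow> x = y"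
  using linear_order by (fastforce simp: order_on_defs dest: antisymD)

lemma (in ordered_abelian_group) gle_linear:
  "\<lbrakk>x \<in> carrier \<Lambda>; y \<in> carrier \<Lambda>\<rbrakk> \<Longrightarrow> x \<preceq> y \<or> y \<preceq> x"
  using linear_order gle_refl by (fastforce simp: order_on_defs total_on_def)

lemma (in ordered_abelian_group) gdist_eq_if_gle:
  assumes "x \<preceq> y" "x \<in> carrier \<Lambda>" "y \<in> carrier \<Lambda>"
  shows "gdist \<Lambda> x y = y \<otimes> inv x"
proof -
  have "x \<otimes> inv y \<preceq> \<one>" "\<one> \<preceq> y \<otimes> inv x"
    using translation_invariant[of x y "inv y"] translation_invariant[of x y "inv x"] assms
    by auto
  then have "x \<otimes> inv y \<preceq> y \<otimes> inv x" using gle_trans assms by blast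
  then show ?thesis by (simp add: gdist_def gmax_def)
qed

lemma (in ordered_abelian_group) gdist_commute:
  assumes "x \<in> carrier \<Lambda>" "y \<in> carrier \<Lambda>"
  shows "gdist \<Lambda> x y = gdist \<Lambda> y x"
  using assms gle_linear gle_antisym
  by (auto simp: gdist_def gmax_def) (metis gle_linear inv_closed m_closed)

text \<open>The linear part \<open>x \<mapsto> \<phi> g x \<otimes> inv (\<phi> g \<one>)\<close> inherits bijectivity and monotonicity from \<open>\<phi> g\<close>.
That it depends multiplicatively on \<open>g\<close> follows by comparing the two expansions of
\<open>\<phi> (g \<otimes> h) x = \<phi> g (\<phi> h x)\<close>. Monotonicity turns distances into differences, on which the
translation cancels.\<close>

lemma (in ordered_abelian_group) affine_action_if_linear_parts:
  assumes act: "group_action G (carrier \<Lambda>) \<phi>"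
    and linear_part:
      "\<And>g. g \<in> carrier G \<Longrightarrow> \<exists>h\<in>hom \<Lambda> \<Lambda>. \<forall>x\<in>carrier \<Lambda>. \<phi> g x = h x \<otimes> \<phi> g \<one>"
    and mono: "\<And>g. g \<in> carrier G \<Longrightarrow> order_preserving \<Lambda> (\<phi> g)"
  shows "affine_action \<Lambda> G \<phi>"
proof -
  interpret group_action G "carrier \<Lambda>" \<phi> by (fact act)
  have clo: "\<phi> g x \<in> carrier \<Lambda>" if "g \<in> carrier G" "x \<in> carrier \<Lambda>" for g x
    using that element_image by blast
  \<comment> \<open>Elements of the automorphism group are extensional, hence the restriction.\<close>
  define \<alpha> where "\<alpha> g = (\<lambda>x\<in>carrier \<Lambda>. \<phi> g x \<otimes> inv (\<phi> g \<one>))" for g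
  have \<alpha>_eq: "\<alpha> g x = \<phi> g x \<otimes> inv (\<phi> g \<one>)" if "x \<in> carrier \<Lambda>" for g x
    using that by (simp add: \<alpha>_def)
  have \<alpha>_clo: "\<alpha> g x \<in> carrier \<Lambda>" if "g \<in> carrier G" "x \<in> carrier \<Lambda>" for g x
    using that clo by (simp add: \<alpha>_eq)
  have \<phi>_eq: "\<phi> g x = \<alpha> g x \<otimes> \<phi> g \<one>" if "g \<in> carrier G" "x \<in> carrier \<Lambda>" for g x
    using that clo by (simp add: \<alpha>_eq m_assoc)
  have \<alpha>_hom: "\<alpha> g \<in> hom \<Lambda> \<Lambda>" if g: "g \<in> carrier G" for g
  proof -
    obtain h where h: "h \<in> hom \<Lambda> \<Lambda>" "\<forall>x\<in>carrier \<Lambda>. \<phi> g x = h x \<otimes> \<phi> g \<one>"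
      using linear_part g by blast
    have hc: "h x \<in> carrier \<Lambda>" if "x \<in> carrier \<Lambda>" for x
      using h(1) that by (rule hom_in_carrier)
    have "\<alpha> g x = h x" if x: "x \<in> carrier \<Lambda>" for x
    proof -
      have "\<phi> g x = h x \<otimes> \<phi> g \<one>" using h x by blast
      then show ?thesis using x hc clo[OF g] by (simp add: \<alpha>_eq m_assoc)
    qed
    then show ?thesis using h(1) by (auto simp: hom_def)
  qed
  have \<alpha>_mult: "\<alpha> (g \<otimes>\<^bsub>G\<^esub> h) x = \<alpha> g (\<alpha> h x)"
    if g: "g \<in> carrier G" and h: "h \<in> carrier G" and x: "x \<in> carrier \<Lambda>" for g h x
  proof -
    have "\<phi> (g \<otimes>\<^bsub>G\<^esub> h) x = \<phi> g (\<phi> h x)" if "x \<in> carrier \<Lambda>" for x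
      using that g h composition_rule by blast
    then have *: "\<phi> (g \<otimes>\<^bsub>G\<^esub> h) x = \<phi> g (\<alpha> h x \<otimes> \<phi> h \<one>)"
      "\<phi> (g \<otimes>\<^bsub>G\<^esub> h) \<one> = \<phi> g (\<phi> h \<one>)"
      using x arg_cong[OF \<phi>_eq[OF h x], of "\<phi> g"] by simp_all
    have "\<phi> g (\<alpha> h x \<otimes> \<phi> h \<one>) = \<alpha> g (\<alpha> h x \<otimes> \<phi> h \<one>) \<otimes> \<phi> g \<one>"
      using \<alpha>_clo clo x g h by (intro \<phi>_eq) auto
    also have "\<dots> = \<alpha> g (\<alpha> h x) \<otimes> \<alpha> g (\<phi> h \<one>) \<otimes> \<phi> g \<one>"
      using \<alpha>_hom[OF g] \<alpha>_clo clo x h by (simp add: hom_mult)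
    also have "\<dots> = \<alpha> g (\<alpha> h x) \<otimes> \<phi> g (\<phi> h \<one>)"
      using \<phi>_eq[OF g clo[OF h one_closed]] \<alpha>_clo clo x g h by (simp add: m_assoc)
    finally show ?thesis
      using * \<alpha>_clo clo x g h by (simp add: \<alpha>_eq[of x] m_assoc)
  qed
  have \<alpha>_bij: "bij_betw (\<alpha> g) (carrier \<Lambda>) (carrier \<Lambda>)" if g: "g \<in> carrier G" for g
  proof -
    have "inj_on (\<alpha> g) (carrier \<Lambda>)"
      using inj_prop[OF g] clo[OF g] by (auto simp: inj_on_def \<alpha>_eq)
    moreover have "y \<in> \<alpha> g ` carrier \<Lambda>" if y: "y \<in> carrier \<Lambda>" for y
    proof -
      obtain x where "x \<in> carrier \<Lambda>" "\<phi> g x = y \<otimes> \<phi> g \<one>"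
        using bij_prop1[OF g, of "y \<otimes> \<phi> g \<one>"] y clo[OF g] by auto
      then show ?thesis using y clo[OF g] by (intro image_eqI[of _ _ x]) (auto simp: \<alpha>_eq m_assoc)
    qed
    ultimately show ?thesis using \<alpha>_clo[OF g] by (auto simp: bij_betw_def)
  qed
  have \<alpha>_Bij: "\<alpha> g \<in> Bij (carrier \<Lambda>)" if "g \<in> carrier G" for g
    using \<alpha>_bij[OF that] by (simp add: Bij_def \<alpha>_def)
  have \<alpha>_mono: "order_preserving \<Lambda> (\<alpha> g)" if "g \<in> carrier G" for g
    using mono[OF that] clo[OF that]
    by (auto simp: order_preserving_def \<alpha>_eq intro!: translation_invariant)
  have "\<alpha> \<in> hom G (Aut_plus \<Lambda>)"
  proof (rule homI)
    show "\<alpha> g \<in> carrier (Aut_plus \<Lambda>)" if "g \<in> carrier G" for g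
      using that \<alpha>_hom \<alpha>_Bij \<alpha>_mono by (simp add: Aut_plus_def auto_def)
    show "\<alpha> (g \<otimes>\<^bsub>G\<^esub> h) = \<alpha> g \<otimes>\<^bsub>Aut_plus \<Lambda>\<^esub> \<alpha> h"
      if "g \<in> carrier G" "h \<in> carrier G" for g h
    proof
      show "\<alpha> (g \<otimes>\<^bsub>G\<^esub> h) x = (\<alpha> g \<otimes>\<^bsub>Aut_plus \<Lambda>\<^esub> \<alpha> h) x" for x
        using that \<alpha>_Bij \<alpha>_mult[OF that, of x]
        by (cases "x \<in> carrier \<Lambda>")
          (auto simp: Aut_plus_def AutoGroup_def BijGroup_def compose_def \<alpha>_def)
    qed
  qed
  moreover have "gdist \<Lambda> (\<phi> g x) (\<phi> g y) = \<alpha> g (gdist \<Lambda> x y)"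
    if g: "g \<in> carrier G" and x: "x \<in> carrier \<Lambda>" and y: "y \<in> carrier \<Lambda>" for g x y
  proof -
    have *: "gdist \<Lambda> (\<phi> g x) (\<phi> g y) = \<alpha> g (gdist \<Lambda> x y)"
      if le: "x \<preceq> y" and x: "x \<in> carrier \<Lambda>" and y: "y \<in> carrier \<Lambda>" for x y
    proof -
      have "\<phi> g x \<preceq> \<phi> g y" using mono[OF g] le x y by (simp add: order_preserving_def)
      then have "gdist \<Lambda> (\<phi> g x) (\<phi> g y) = \<phi> g y \<otimes> inv \<phi> g x"
        using gdist_eq_if_gle clo g x y by simp
      also have "\<dots> = \<alpha> g (y \<otimes> inv x)"
      proof -
        have "\<alpha> g (y \<otimes> inv x) \<otimes> \<alpha> g x = \<alpha> g (y \<otimes> inv x \<otimes> x)"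
          using \<alpha>_hom[OF g] x y by (simp add: hom_mult)
        also have "\<dots> = \<alpha> g y" using x y by (simp add: m_assoc)
        finally have "\<phi> g y = \<alpha> g (y \<otimes> inv x) \<otimes> \<phi> g x"
          using \<phi>_eq[OF g x] \<phi>_eq[OF g y] \<alpha>_clo[OF g] clo[OF g] x y
          by (metis inv_closed m_assoc m_closed one_closed)
        then show ?thesis
          using \<alpha>_clo[OF g] clo[OF g] x y by (metis inv_closed m_closed inv_solve_right)
      qed
      finally show ?thesis using gdist_eq_if_gle[OF le x y] by simp
    qed
    show ?thesis
      using gle_linear[OF x y] *[OF _ x y] *[OF _ y x] gdist_commute x y clo[OF g] by metis
  qed
  ultimately show ?thesis
    using act mono ordered_abelian_group_axioms
    by (auto simp: affine_action_def alpha_affine_action_def)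
qed

text \<open>A map moving all points upwards moves the right end of a segment out of it, and its inverse
moves the left end out. An empty segment has no proper subset.\<close>

lemma (in ordered_abelian_group) rigid_if_increasing:
  assumes bij: "bij_betw f (carrier \<Lambda>) (carrier \<Lambda>)"
    and up: "\<And>x. x \<in> carrier \<Lambda> \<Longrightarrow> x \<preceq> f x \<and> f x \<noteq> x"
  shows "rigid \<Lambda> f"
  unfolding rigid_def
proof (intro ballI conjI notI)
  fix a b assume ab: "a \<in> carrier \<Lambda>" "b \<in> carrier \<Lambda>"
  have ends: "a \<in> segment \<Lambda> a b \<and> b \<in> segment \<Lambda> a b" if "segment \<Lambda> a b \<noteq> {}"
    using that ab gle_trans[of a _ b] gle_refl by (auto simp: segment_def)
  show False if "f ` segment \<Lambda> a b \<subset> segment \<Lambda> a b"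
  proof -
    have "f b \<in> segment \<Lambda> a b" using that ends by blast
    then show False using up[of b] gle_antisym[of b "f b"] ab by (auto simp: segment_def)
  qed
  show False if "inv_into (carrier \<Lambda>) f ` segment \<Lambda> a b \<subset> segment \<Lambda> a b"
  proof -
    have "inv_into (carrier \<Lambda>) f a \<in> segment \<Lambda> a b" using that ends by blast
    moreover have "f (inv_into (carrier \<Lambda>) f a) = a"
      using bij ab by (simp add: bij_betw_inv_into_right)
    ultimately show False
      using up[of "inv_into (carrier \<Lambda>) f a"] gle_antisym[of a "inv_into (carrier \<Lambda>) f a"] ab
      by (auto simp: segment_def)
  qed
qed

lemma (in ordered_abelian_group) rigid_if_decreasing:
  assumes bij: "bij_betw f (carrier \<Lambda>) (carrier \<Lambda>)"
    and down: "\<And>x. x \<in> carrier \<Lambda> \<Longrightarrow> f x \<preceq> x \<and> f x \<noteq> x"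
  shows "rigid \<Lambda> f"
  unfolding rigid_def
proof (intro ballI conjI notI)
  fix a b assume ab: "a \<in> carrier \<Lambda>" "b \<in> carrier \<Lambda>"
  have ends: "a \<in> segment \<Lambda> a b \<and> b \<in> segment \<Lambda> a b" if "segment \<Lambda> a b \<noteq> {}"
    using that ab gle_trans[of a _ b] gle_refl by (auto simp: segment_def)
  show False if "f ` segment \<Lambda> a b \<subset> segment \<Lambda> a b"
  proof -
    have "f a \<in> segment \<Lambda> a b" using that ends by blast
    then show False using down[of a] gle_antisym[of a "f a"] ab by (auto simp: segment_def)
  qed
  show False if "inv_into (carrier \<Lambda>) f ` segment \<Lambda> a b \<subset> segment \<Lambda> a b"
  proof -
    have "inv_into (carrier \<Lambda>) f b \<in> segment \<Lambda> a b" using that ends by blast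
    moreover have "f (inv_into (carrier \<Lambda>) f b) = b"
      using bij ab by (simp add: bij_betw_inv_into_right)
    ultimately show False
      using down[of "inv_into (carrier \<Lambda>) f b"] gle_antisym[of b "inv_into (carrier \<Lambda>) f b"] ab
      by (auto simp: segment_def)
  qed
qed

lemma rigid_hyperbolic_if_leading_coordinate_shifted:
  assumes bij: "bij_betw f (carrier_vec k) (carrier_vec k)"
    and p: "p < k" and c: "c \<noteq> 0"
    and fixed: "\<And>x m. \<lbrakk>x \<in> carrier_vec k; m < p\<rbrakk> \<Longrightarrow> f x $ m = x $ m"
    and shift: "\<And>x. x \<in> carrier_vec k \<Longrightarrow> f x $ p = x $ p + c"
  shows "rigid (lex_group k) f \<and> hyperbolic (lex_group k) f"
proof -
  interpret ordered_abelian_group "lex_group k" by (rule ordered_abelian_group_lex_group)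
  have ne: "f x \<noteq> x" if "x \<in> carrier_vec k" for x
    using shift[OF that] c by auto
  have "rigid (lex_group k) f"
  proof (cases "c > 0")
    case True
    then have "lex_le k x (f x)" if "x \<in> carrier_vec k" for x
      using fixed[OF that] shift[OF that] p by (auto simp: lex_le_def)
    then show ?thesis using rigid_if_increasing[of f] bij ne by simp
  next
    case False
    then have "lex_le k (f x) x" if "x \<in> carrier_vec k" for x
      using fixed[OF that] shift[OF that] p c
      unfolding lex_le_def by (intro disjI2 exI[of _ p]) auto
    then show ?thesis using rigid_if_decreasing[of f] bij ne by simp
  qed
  then show ?thesis using ne by (simp add: hyperbolic_def)
qed

lemma group_action_if_composition:
  assumes "group G"
    and ext: "\<And>g. g \<in> carrier G \<Longrightarrow> \<phi> g \<in> extensional E"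
    and clo: "\<And>g x. \<lbrakk>g \<in> carrier G; x \<in> E\<rbrakk> \<Longrightarrow> \<phi> g x \<in> E"
    and one: "\<And>x. x \<in> E \<Longrightarrow> \<phi> \<one>\<^bsub>G\<^esub> x = x"
    and comp: "\<And>g h x. \<lbrakk>g \<in> carrier G; h \<in> carrier G; x \<in> E\<rbrakk>
      \<Longrightarrow> \<phi> (g \<otimes>\<^bsub>G\<^esub> h) x = \<phi> g (\<phi> h x)"
  shows "group_action G E \<phi>"
proof -
  interpret group G by fact
  have bij: "\<phi> g \<in> Bij E" if g: "g \<in> carrier G" for g
  proof -
    have "\<phi> (inv\<^bsub>G\<^esub> g) (\<phi> g x) = x" "\<phi> g (\<phi> (inv\<^bsub>G\<^esub> g) x) = x" if "x \<in> E" for x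
      using g that comp[of "inv\<^bsub>G\<^esub> g" g x] comp[of g "inv\<^bsub>G\<^esub> g" x] one by simp_all
    then have "bij_betw (\<phi> g) E E"
      using g clo by (intro bij_betwI[where g = "\<phi> (inv\<^bsub>G\<^esub> g)"]) auto
    then show ?thesis using ext g by (simp add: Bij_def)
  qed
  have "\<phi> \<in> hom G (BijGroup E)"
  proof (rule homI)
    show "\<phi> g \<in> carrier (BijGroup E)" if "g \<in> carrier G" for g
      using bij that by (simp add: BijGroup_def)
    show "\<phi> (g \<otimes>\<^bsub>G\<^esub> h) = \<phi> g \<otimes>\<^bsub>BijGroup E\<^esub> \<phi> h"
      if "g \<in> carrier G" "h \<in> carrier G" for g h
    proof
      show "\<phi> (g \<otimes>\<^bsub>G\<^esub> h) x = (\<phi> g \<otimes>\<^bsub>BijGroup E\<^esub> \<phi> h) x" for x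
        using that bij comp[OF that, of x] ext[of "g \<otimes>\<^bsub>G\<^esub> h"]
        by (cases "x \<in> E") (auto simp: BijGroup_def compose_def extensional_def)
    qed
  qed
  then show ?thesis
    by (intro group_action.intro group_hom.intro group_hom_axioms.intro group_BijGroup)
      (rule is_group)
qed

section \<open>Upper triangular matrices\<close>

lemma upper_triangular_mult_index:
  fixes A B :: "'a :: semiring_0 mat"
  assumes A: "A \<in> carrier_mat n n" "upper_triangular A"
    and B: "B \<in> carrier_mat n n" "upper_triangular B"
    and ij: "i < n" "j < n"
  shows "(A * B) $$ (i, j) = (\<Sum>l=i..j. A $$ (i, l) * B $$ (l, j))"
proof -
  have "(A * B) $$ (i, j) = (\<Sum>l=0..<n. A $$ (i, l) * B $$ (l, j))"
    using assms by (auto simp: scalar_prod_def)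
  also have "\<dots> = (\<Sum>l=i..j. A $$ (i, l) * B $$ (l, j))"
    using assms by (intro sum.mono_neutral_right) (auto simp: upper_triangular_def not_le)
  finally show ?thesis .
qed

lemma upper_triangular_mult:
  fixes A B :: "'a :: semiring_0 mat"
  assumes "A \<in> carrier_mat n n" "upper_triangular A" "B \<in> carrier_mat n n" "upper_triangular B"
  shows "upper_triangular (A * B)"
  using assms upper_triangular_mult_index[OF assms] by (auto simp: upper_triangular_def)

text \<open>For \<open>j < i\<close>, the entry \<open>(i, j)\<close> of \<open>B A = 1\<close> reads \<open>B\<^sub>i\<^sub>j A\<^sub>j\<^sub>j = 0\<close> once the entries of \<open>B\<close> in row \<open>i\<close>
to the left of \<open>j\<close> are known to vanish.\<close>

lemma upper_triangular_left_inverse: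
  fixes A B :: "'a :: field mat"
  assumes A: "A \<in> carrier_mat n n" "upper_triangular A"
    and diag: "\<And>i. i < n \<Longrightarrow> A $$ (i, i) \<noteq> 0"
    and B: "B \<in> carrier_mat n n" and BA: "B * A = 1\<^sub>m n"
  shows "upper_triangular B"
proof -
  have "B $$ (i, j) = 0" if "j < i" "i < n" for i j
    using that
  proof (induction j rule: less_induct)
    case (less j)
    have "0 = (B * A) $$ (i, j)" using less.prems by (simp add: BA)
    also have "\<dots> = (\<Sum>l=0..<n. B $$ (i, l) * A $$ (l, j))"
      using A(1) B less.prems by (auto simp: scalar_prod_def)
    also have "\<dots> = (\<Sum>l\<in>{j}. B $$ (i, l) * A $$ (l, j))"
    proof (intro sum.mono_neutral_right ballI)
      fix l assume l: "l \<in> {0..<n} - {j}"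
      show "B $$ (i, l) * A $$ (l, j) = 0"
      proof (cases "l < j")
        case True
        then show ?thesis using less by simp
      next
        case False
        then have "A $$ (l, j) = 0" using l A by (auto simp: upper_triangular_def)
        then show ?thesis by simp
      qed
    qed (use less.prems in auto)
    finally show ?case using diag[of j] less.prems by simp
  qed
  then show ?thesis using B by (auto simp: upper_triangular_def)
qed

lemma pos_upper_triangular_group_simps:
  "carrier (pos_upper_triangular_group n) =
    {A \<in> carrier_mat n n. upper_triangular A \<and> (\<forall>i<n. A $$ (i, i) > 0)}"
  "monoid.mult (pos_upper_triangular_group n) = (*)"
  "one (pos_upper_triangular_group n) = 1\<^sub>m n"
  by (simp_all add: pos_upper_triangular_group_def)

lemma group_pos_upper_triangular: "group (pos_upper_triangular_group n)"
proof (rule groupI; unfold pos_upper_triangular_group_simps)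
  fix A :: "real mat"
  assume "A \<in> {A \<in> carrier_mat n n. upper_triangular A \<and> (\<forall>i<n. A $$ (i, i) > 0)}"
  then have A: "A \<in> carrier_mat n n" "upper_triangular A" and pos: "\<And>i. i < n \<Longrightarrow> A $$ (i, i) > 0"
    by auto
  have "det A \<noteq> 0"
    using A pos by (auto simp: det_upper_triangular diag_mat_def)
      (metis less_irrefl)
  then obtain B where B: "B \<in> carrier_mat n n" "B * A = 1\<^sub>m n"
    using det_non_zero_imp_unit[OF A(1), of "()"] by (auto simp: Units_def ring_mat_def)
  have ut: "upper_triangular B"
    using upper_triangular_left_inverse[OF A _ B] pos by fastforce
  have "B $$ (i, i) > 0" if "i < n" for i
  proof -
    have "B $$ (i, i) * A $$ (i, i) = 1"
      using upper_triangular_mult_index[OF B(1) ut A that that] B(2) that by simp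
    then show ?thesis using pos[OF that] zero_less_mult_pos2[of "B $$ (i, i)" "A $$ (i, i)"] by simp
  qed
  with B ut show "\<exists>B\<in>{A \<in> carrier_mat n n. upper_triangular A \<and> (\<forall>i<n. A $$ (i, i) > 0)}.
    B * A = 1\<^sub>m n" by blast
next
  fix A B :: "real mat"
  assume A: "A \<in> {A \<in> carrier_mat n n. upper_triangular A \<and> (\<forall>i<n. A $$ (i, i) > 0)}"
    and B: "B \<in> {A \<in> carrier_mat n n. upper_triangular A \<and> (\<forall>i<n. A $$ (i, i) > 0)}"
  have "(A * B) $$ (i, i) > 0" if "i < n" for i
  proof -
    have "(A * B) $$ (i, i) = A $$ (i, i) * B $$ (i, i)"
      using A B that by (subst upper_triangular_mult_index) auto
    then show ?thesis using A B that by simp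
  qed
  then show "A * B \<in> {A \<in> carrier_mat n n. upper_triangular A \<and> (\<forall>i<n. A $$ (i, i) > 0)}"
    using A B upper_triangular_mult[of A n B] by auto
qed auto

section \<open>The action of triangular matrices on coordinates\<close>

section \<open>Triangular matrices acting on a lexicographic space\<close>

text \<open>The entry \<open>(i, j)\<close> with \<open>i \<le> j < n\<close> is stored at the coordinate \<open>(j - i) n + i\<close> of a space of
dimension \<open>n\<^sup>2\<close>, so that entries closer to the diagonal are more significant. The first \<open>n\<close>
coordinates belong to the diagonal. This addressing leaves gaps, because the diagonal at
distance \<open>d\<close> has only \<open>n - d\<close> entries; the group fixes the slack coordinates.\<close>

definition coord :: "nat \<Rightarrow> nat \<Rightarrow> nat \<Rightarrow> nat" where
  "coord n i j = (j - i) * n + i"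

lemma coord_div_mod:
  assumes "i < n"
  shows "coord n i j mod n = i" "coord n i j div n = j - i"
  using assms by (auto simp: coord_def)

lemma coord_less:
  assumes "i \<le> j" "j < n"
  shows "coord n i j < n * n"
proof -
  have "coord n i j < (j - i + 1) * n" using assms by (simp add: coord_def)
  also have "\<dots> \<le> n * n" using assms by (intro mult_right_mono) auto
  finally show ?thesis .
qed

lemma coord_less_if_right:
  assumes "i < l" "l \<le> j" "j < n"
  shows "coord n l j < coord n i j"
proof -
  have "coord n l j < (j - l + 1) * n" using assms by (simp add: coord_def)
  also have "\<dots> \<le> (j - i) * n" using assms by (intro mult_right_mono) auto
  also have "\<dots> \<le> coord n i j" by (simp add: coord_def)
  finally show ?thesis .
qed

lemma coord_less_if_left:
  assumes "i \<le> l" "l < j" "0 < n"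
  shows "coord n i l < coord n i j"
proof -
  have "(l - i) * n < (j - i) * n"
    using assms by (intro mult_strict_right_mono diff_less_mono) auto
  then show ?thesis by (simp add: coord_def)
qed

lemma le_coord:
  assumes "i < j"
  shows "n \<le> coord n i j"
proof -
  have "1 * n \<le> (j - i) * n" using assms by (intro mult_right_mono) auto
  also have "\<dots> \<le> coord n i j" by (simp add: coord_def)
  finally show ?thesis by simp
qed

lemma coordinate_cases:
  assumes "m < n * n"
  obtains (diagonal) "m < n"
  | (entry) i j where "i < j" "j < n" "m = coord n i j"
  | (slack) "n \<le> m" "n \<le> m mod n + m div n"
proof -
  have n: "0 < n" using assms by (cases n) auto
  show thesis
  proof (cases "m < n \<or> n \<le> m mod n + m div n")
    case True
    then show ?thesis using that(1,3) by (cases "m < n") auto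
  next
    case False
    then have "0 < m div n" using n by (simp add: div_greater_zero_iff)
    moreover have "m = coord n (m mod n) (m mod n + m div n)" by (simp add: coord_def)
    ultimately show ?thesis using that(2)[of "m mod n" "m mod n + m div n"] False by simp
  qed
qed

text \<open>The homogeneous and the constant part of \<open>g u diag(g)\<^sup>-\<^sup>1\<close>, the latter coming from the ones on the
diagonal of \<open>u\<close>. On the first \<open>n\<close> coordinates the group acts by translations only, which take
products to sums by means of the logarithm.\<close>

definition linear_part :: "nat \<Rightarrow> real mat \<Rightarrow> real vec \<Rightarrow> real vec" where
  "linear_part n g x = vec (n * n) (\<lambda>m. let i = m mod n; j = i + m div n in
     if i < j \<and> j < n then (\<Sum>l=i..<j. g $$ (i, l) * x $ coord n l j) / g $$ (j, j) else x $ m)"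

definition translation_part :: "nat \<Rightarrow> real mat \<Rightarrow> real vec" where
  "translation_part n g = vec (n * n) (\<lambda>m. let i = m mod n; j = i + m div n in
     if i = j then ln (g $$ (i, i)) else if j < n then g $$ (i, j) / g $$ (j, j) else 0)"

definition triangular_act :: "nat \<Rightarrow> real mat \<Rightarrow> real vec \<Rightarrow> real vec" where
  "triangular_act n g = (\<lambda>x\<in>carrier_vec (n * n). linear_part n g x + translation_part n g)"

definition unitriangular :: "nat \<Rightarrow> real vec \<Rightarrow> real mat" where
  "unitriangular n x = mat n n (\<lambda>(i, j). if i < j then x $ coord n i j else if i = j then 1 else 0)"

lemma linear_part_carrier [simp]: "linear_part n g x \<in> carrier_vec (n * n)"
  by (simp add: linear_part_def)

lemma translation_part_carrier [simp]: "translation_part n g \<in> carrier_vec (n * n)"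
  by (simp add: translation_part_def)

lemma dim_parts [simp]:
  "dim_vec (linear_part n g x) = n * n" "dim_vec (translation_part n g) = n * n"
  by (simp_all add: linear_part_def translation_part_def)

lemma linear_part_entry:
  assumes "i < j" "j < n"
  shows "linear_part n g x $ coord n i j =
    (\<Sum>l=i..<j. g $$ (i, l) * x $ coord n l j) / g $$ (j, j)"
  using assms coord_less[of i j n] by (simp add: linear_part_def coord_div_mod Let_def)

lemma linear_part_not_entry:
  assumes "m < n * n" "m < n \<or> n \<le> m mod n + m div n"
  shows "linear_part n g x $ m = x $ m"
  using assms by (auto simp: linear_part_def Let_def)

lemma translation_part_diagonal:
  assumes "i < n"
  shows "translation_part n g $ i = ln (g $$ (i, i))"
  using assms coord_less[of i i n] by (simp add: translation_part_def Let_def coord_def)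

lemma translation_part_entry:
  assumes "i < j" "j < n"
  shows "translation_part n g $ coord n i j = g $$ (i, j) / g $$ (j, j)"
  using assms coord_less[of i j n] by (simp add: translation_part_def coord_div_mod Let_def)

lemma translation_part_slack:
  assumes "m < n * n" "n \<le> m" "n \<le> m mod n + m div n"
  shows "translation_part n g $ m = 0"
proof -
  have "0 < n" using assms(1) by (cases n) auto
  then have "0 < m div n" using assms(2) by (simp add: div_greater_zero_iff)
  then show ?thesis using assms by (simp add: translation_part_def Let_def)
qed

lemma act_index:
  assumes "x \<in> carrier_vec (n * n)" "m < n * n"
  shows "triangular_act n g x $ m = linear_part n g x $ m + translation_part n g $ m"
  using assms by (simp add: triangular_act_def)

lemma unitriangular_carrier [simp]: "unitriangular n x \<in> carrier_mat n n"
  by (simp add: unitriangular_def)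

lemma upper_triangular_unitriangular: "upper_triangular (unitriangular n x)"
  by (auto simp: unitriangular_def)

context
  fixes n :: nat and g :: "real mat"
  assumes g: "g \<in> carrier (pos_upper_triangular_group n)"
begin

lemma triangular_carrier: "g \<in> carrier_mat n n" and triangular_upper: "upper_triangular g"
  and triangular_diagonal_pos: "\<And>i. i < n \<Longrightarrow> g $$ (i, i) > 0"
  using g by (auto simp: pos_upper_triangular_group_simps)

lemma act_entry:
  assumes x: "x \<in> carrier_vec (n * n)" and ij: "i < j" "j < n"
  shows "triangular_act n g x $ coord n i j = (g * unitriangular n x) $$ (i, j) / g $$ (j, j)"
proof -
  have "(g * unitriangular n x) $$ (i, j) =
      (\<Sum>l=i..j. g $$ (i, l) * unitriangular n x $$ (l, j))"
    using ij by (intro upper_triangular_mult_index)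
      (auto simp: triangular_carrier triangular_upper upper_triangular_unitriangular)
  also have "\<dots> = (\<Sum>l=i..<j. g $$ (i, l) * unitriangular n x $$ (l, j)) + g $$ (i, j)"
    using ij by (simp add: sum.last_plus unitriangular_def)
  also have "(\<Sum>l=i..<j. g $$ (i, l) * unitriangular n x $$ (l, j)) =
      (\<Sum>l=i..<j. g $$ (i, l) * x $ coord n l j)"
    using ij by (intro sum.cong) (auto simp: unitriangular_def)
  finally show ?thesis
    using act_index[OF x coord_less[of i j n]] ij
    by (simp add: linear_part_entry translation_part_entry add_divide_distrib)
qed

text \<open>Written with matrices, the action is \<open>u \<mapsto> g u diag(g)\<^sup>-\<^sup>1\<close>; in this form its compatibility with
products is associativity of the matrix product.\<close>

lemma unitriangular_act:
  assumes x: "x \<in> carrier_vec (n * n)" and ij: "i < n" "j < n"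
  shows "unitriangular n (triangular_act n g x) $$ (i, j) = (g * unitriangular n x) $$ (i, j) / g $$ (j, j)"
proof (cases i j rule: linorder_cases)
  case less
  then show ?thesis using act_entry[OF x] ij by (simp add: unitriangular_def)
next
  case equal
  have "(g * unitriangular n x) $$ (j, j) = g $$ (j, j)"
    using ij by (subst upper_triangular_mult_index)
      (auto simp: triangular_carrier triangular_upper upper_triangular_unitriangular, simp add: unitriangular_def)
  then show ?thesis using equal ij triangular_diagonal_pos[of j] by (simp add: unitriangular_def)
next
  case greater
  then have "(g * unitriangular n x) $$ (i, j) = 0"
    using upper_triangular_mult[OF triangular_carrier triangular_upper unitriangular_carrier
        upper_triangular_unitriangular] ij triangular_carrier
    by (auto simp: upper_triangular_def)
  then show ?thesis using greater ij by (simp add: unitriangular_def)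
qed

text \<open>If \<open>x\<close> and \<open>y\<close> first differ at the coordinate \<open>m\<close>, then so do their images, since a coordinate
of the image involves only the corresponding coordinate, with a positive coefficient, and more
significant ones.\<close>

lemma act_order_preserving: "order_preserving (lex_group (n * n)) (triangular_act n g)"
proof -
  have strict: "lex_le (n * n) (triangular_act n g x) (triangular_act n g y)"
    if x: "x \<in> carrier_vec (n * n)" and y: "y \<in> carrier_vec (n * n)"
      and m: "m < n * n" and eq: "\<forall>m'<m. x $ m' = y $ m'" and less: "x $ m < y $ m" for x y m
  proof -
    have below: "linear_part n g x $ m' = linear_part n g y $ m'" if "m' < m" for m'
    proof -
      have "m' < n * n" using that m by simp
      then show ?thesis
      proof (cases rule: coordinate_cases)
        case (entry i j)
        have "coord n l j < m" if "l \<in> {i..<j}" for l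
          using that coord_less_if_right[of i l j n] entry \<open>m' < m\<close> by (cases "l = i") auto
        then show ?thesis using eq entry by (simp add: linear_part_entry)
      qed (use that eq m in \<open>auto simp: linear_part_not_entry\<close>)
    qed
    have "linear_part n g x $ m < linear_part n g y $ m"
      using m
    proof (cases rule: coordinate_cases)
      case (entry i j)
      have "x $ coord n l j = y $ coord n l j" if "l \<in> {Suc i..<j}" for l
        using that coord_less_if_right[of i l j n] entry eq by auto
      moreover have "g $$ (i, i) * x $ coord n i j < g $$ (i, i) * y $ coord n i j"
        using less entry triangular_diagonal_pos[of i] by simp
      ultimately have "(\<Sum>l=i..<j. g $$ (i, l) * x $ coord n l j) <
          (\<Sum>l=i..<j. g $$ (i, l) * y $ coord n l j)"
        using entry by (simp add: sum.atLeast_Suc_lessThan)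
      then show ?thesis using entry triangular_diagonal_pos[of j] by (simp add: linear_part_entry divide_strict_right_mono)
    qed (use less m in \<open>auto simp: linear_part_not_entry\<close>)
    then show ?thesis
      using below m x y unfolding lex_le_def by (intro disjI2 exI[of _ m]) (auto simp: act_index)
  qed
  have "lex_le (n * n) (triangular_act n g x) (triangular_act n g y)"
    if "x \<in> carrier_vec (n * n)" "y \<in> carrier_vec (n * n)" "lex_le (n * n) x y" for x y
  proof (cases "x = y")
    case False
    with that(3) obtain m where "m < n * n" "\<forall>m'<m. x $ m' = y $ m'" "x $ m < y $ m"
      by (auto simp: lex_le_def)
    then show ?thesis using strict that by blast
  qed (simp add: lex_le_def)
  then show ?thesis by (simp add: order_preserving_def)
qed

lemma linear_part_hom: "linear_part n g \<in> hom (lex_group (n * n)) (lex_group (n * n))"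
proof (rule homI)
  fix x y assume "x \<in> carrier (lex_group (n * n))" "y \<in> carrier (lex_group (n * n))"
  then have xy: "x \<in> carrier_vec (n * n)" "y \<in> carrier_vec (n * n)" by simp_all
  have "linear_part n g (x + y) = linear_part n g x + linear_part n g y"
  proof (rule eq_vecI)
    fix m assume "m < dim_vec (linear_part n g x + linear_part n g y)"
    then have m: "m < n * n" by simp
    then show "linear_part n g (x + y) $ m = (linear_part n g x + linear_part n g y) $ m"
    proof (cases rule: coordinate_cases)
      case (entry i j)
      have "(x + y) $ coord n l j = x $ coord n l j + y $ coord n l j" if "l \<in> {i..<j}" for l
        using that coord_less[of l j n] entry xy by simp
      then show ?thesis
        using entry m by (simp add: linear_part_entry distrib_left sum.distrib add_divide_distrib)
    qed (use m xy in \<open>auto simp: linear_part_not_entry\<close>)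
  qed simp
  then show "linear_part n g (x \<otimes>\<^bsub>lex_group (n * n)\<^esub> y) =
      linear_part n g x \<otimes>\<^bsub>lex_group (n * n)\<^esub> linear_part n g y" by simp
qed simp

text \<open>At the coordinate of an entry \<open>(i, j)\<close> above the diagonal, all diagonal coordinates are more
significant, so the hypothesis makes the diagonal of \<open>g\<close> trivial; it also gives \<open>g\<^sub>i\<^sub>l = 0\<close> for
\<open>i < l < j\<close>, as \<open>(i, l)\<close> is closer to the diagonal. The sum in the linear part reduces to its
term \<open>l = i\<close>.\<close>

lemma act_index_if_translation_part_zero_below:
  assumes x: "x \<in> carrier_vec (n * n)" and m: "m < n * n"
    and zero: "\<And>m'. m' < m \<Longrightarrow> translation_part n g $ m' = 0"
  shows "triangular_act n g x $ m = x $ m + translation_part n g $ m"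
proof -
  have "linear_part n g x $ m = x $ m"
    using m
  proof (cases rule: coordinate_cases)
    case (entry i j)
    have diag: "g $$ (l, l) = 1" if l: "l < n" for l
      using zero[of l] le_coord[of i j n] entry l triangular_diagonal_pos[OF l] by (simp add: translation_part_diagonal)
    have "g $$ (i, l) = 0" if l: "l \<in> {Suc i..<j}" for l
      using zero[of "coord n i l"] coord_less_if_left[of i l j n] l entry diag[of l]
      by (simp add: translation_part_entry)
    then have "(\<Sum>l=i..<j. g $$ (i, l) * x $ coord n l j) = x $ m"
      using entry diag[of i] by (simp add: sum.atLeast_Suc_lessThan)
    then show ?thesis using entry diag[of j] by (simp add: linear_part_entry)
  qed (use m in \<open>auto simp: linear_part_not_entry\<close>)
  then show ?thesis using act_index[OF x m] by simp
qed

lemma eq_one_if_translation_part_zero: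
  assumes zero: "\<And>m. m < n * n \<Longrightarrow> translation_part n g $ m = 0"
  shows "g = 1\<^sub>m n"
proof (rule eq_matI)
  have diag: "g $$ (j, j) = 1" if j: "j < n" for j
    using zero[of j] coord_less[of j j n] j triangular_diagonal_pos[OF j]
    by (simp add: translation_part_diagonal coord_def)
  fix i j assume "i < dim_row (1\<^sub>m n)" "j < dim_col (1\<^sub>m n)"
  then have ij: "i < n" "j < n" by simp_all
  show "g $$ (i, j) = 1\<^sub>m n $$ (i, j)"
  proof (cases i j rule: linorder_cases)
    case less
    then show ?thesis
      using zero[OF coord_less, of i j] ij diag[of j] by (simp add: translation_part_entry)
  next
    case greater
    then show ?thesis using triangular_upper triangular_carrier ij by (auto simp: upper_triangular_def)
  qed (use ij diag in auto)
qed (use triangular_carrier in auto)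

end

lemma act_carrier: "x \<in> carrier_vec (n * n) \<Longrightarrow> triangular_act n g x \<in> carrier_vec (n * n)"
  by (simp add: triangular_act_def)

lemma group_action_act:
  "group_action (pos_upper_triangular_group n) (carrier_vec (n * n)) (triangular_act n)"
proof (rule group_action_if_composition)
  let ?T = "pos_upper_triangular_group n"
  interpret group ?T by (rule group_pos_upper_triangular)
  show "triangular_act n \<one>\<^bsub>?T\<^esub> x = x" if x: "x \<in> carrier_vec (n * n)" for x
  proof (rule eq_vecI)
    fix m assume "m < dim_vec x"
    then have m: "m < n * n" using x by simp
    have zero: "translation_part n \<one>\<^bsub>?T\<^esub> $ m' = 0" if "m' < n * n" for m'
      using that
    proof (cases rule: coordinate_cases)
      case diagonal
      then show ?thesis by (simp add: translation_part_diagonal pos_upper_triangular_group_simps)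
    next
      case (entry i j)
      then show ?thesis by (simp add: translation_part_entry pos_upper_triangular_group_simps)
    qed (use that in \<open>simp add: translation_part_slack\<close>)
    show "triangular_act n \<one>\<^bsub>?T\<^esub> x $ m = x $ m"
      using act_index_if_translation_part_zero_below[OF one_closed x m] zero m by simp
  qed (use x act_carrier[of x n] in auto)
  show "triangular_act n (g \<otimes>\<^bsub>?T\<^esub> h) x = triangular_act n g (triangular_act n h x)"
    if g: "g \<in> carrier ?T" and h: "h \<in> carrier ?T" and x: "x \<in> carrier_vec (n * n)" for g h x
  proof (rule eq_vecI)
    note cg = triangular_carrier[OF g] and ch = triangular_carrier[OF h] and hx = act_carrier[OF x, of h]
    have gh: "g * h \<in> carrier ?T" using g h m_closed by (simp add: pos_upper_triangular_group_simps)
    have diag: "(g * h) $$ (i, i) = g $$ (i, i) * h $$ (i, i)" if "i < n" for i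
      using that by (subst upper_triangular_mult_index[OF cg triangular_upper[OF g] ch triangular_upper[OF h]]) auto
    fix m assume "m < dim_vec (triangular_act n g (triangular_act n h x))"
    then have m: "m < n * n" using act_carrier[OF hx, of g] by auto
    have "triangular_act n (g * h) x $ m = triangular_act n g (triangular_act n h x) $ m"
      using m
    proof (cases rule: coordinate_cases)
      case diagonal
      then show ?thesis
        using m x hx diag[of m] triangular_diagonal_pos[OF g, of m] triangular_diagonal_pos[OF h, of m]
        by (simp add: act_index linear_part_not_entry translation_part_diagonal ln_mult)
    next
      case (entry i j)
      have g_mult: "(g * V) $$ (i, j) = (\<Sum>l=0..<n. g $$ (i, l) * V $$ (l, j))"
        if "V \<in> carrier_mat n n" for V
        using entry cg that by (auto simp: scalar_prod_def)
      have "(g * unitriangular n (triangular_act n h x)) $$ (i, j) =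
          (\<Sum>l=0..<n. g $$ (i, l) * unitriangular n (triangular_act n h x) $$ (l, j))"
        by (simp add: g_mult)
      also have "\<dots> = (\<Sum>l=0..<n. g $$ (i, l) * ((h * unitriangular n x) $$ (l, j) / h $$ (j, j)))"
        using entry unitriangular_act[OF h x] by (intro sum.cong) auto
      also have "\<dots> = (g * (h * unitriangular n x)) $$ (i, j) / h $$ (j, j)"
        using g_mult[of "h * unitriangular n x"] ch unitriangular_carrier[of n x]
        by (simp add: sum_divide_distrib del: index_mult_mat)
      also have "g * (h * unitriangular n x) = g * h * unitriangular n x"
        using cg ch by (simp add: assoc_mult_mat[of _ n n _ n _ n])
      finally show ?thesis
        using entry act_entry[OF gh x] act_entry[OF g hx] diag[of j] by (simp add: mult.commute)
    next
      case slack
      then show ?thesis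
        using m x hx by (simp add: act_index linear_part_not_entry translation_part_slack)
    qed
    then show "triangular_act n (g \<otimes>\<^bsub>?T\<^esub> h) x $ m = triangular_act n g (triangular_act n h x) $ m"
      by (simp add: pos_upper_triangular_group_simps)
  qed (simp add: carrier_vecD[OF act_carrier[OF x]] carrier_vecD[OF act_carrier[OF act_carrier[OF x]]])
qed (auto simp: group_pos_upper_triangular act_carrier triangular_act_def)

lemma affine_action_act:
  "affine_action (lex_group (n * n)) (pos_upper_triangular_group n) (triangular_act n)"
proof -
  interpret ordered_abelian_group "lex_group (n * n)" by (rule ordered_abelian_group_lex_group)
  show ?thesis
  proof (rule affine_action_if_linear_parts)
    fix g assume g: "g \<in> carrier (pos_upper_triangular_group n)"
    have "linear_part n g (0\<^sub>v (n * n)) = 0\<^sub>v (n * n)"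
      using hom_one[OF linear_part_hom[OF g]] is_group by simp
    then have "triangular_act n g x = linear_part n g x + triangular_act n g (0\<^sub>v (n * n))"
      if "x \<in> carrier_vec (n * n)" for x
      using that by (simp add: triangular_act_def)
    then show "\<exists>h\<in>hom (lex_group (n * n)) (lex_group (n * n)).
        \<forall>x\<in>carrier (lex_group (n * n)). triangular_act n g x =
          h x \<otimes>\<^bsub>lex_group (n * n)\<^esub> triangular_act n g \<one>\<^bsub>lex_group (n * n)\<^esub>"
      by (intro bexI[OF _ linear_part_hom[OF g]]) (simp only: lex_group_simps, blast)
  qed (auto simp: group_action_act act_order_preserving)
qed

lemma rigid_hyperbolic_act:
  assumes g: "g \<in> carrier (pos_upper_triangular_group n)" and ne: "g \<noteq> 1\<^sub>m n"
  shows "rigid (lex_group (n * n)) (triangular_act n g) \<and> hyperbolic (lex_group (n * n)) (triangular_act n g)"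
proof -
  let ?P = "\<lambda>m. m < n * n \<and> translation_part n g $ m \<noteq> 0"
  define p where "p = (LEAST m. ?P m)"
  have "\<exists>m. ?P m" using eq_one_if_translation_part_zero[OF g] ne by blast
  then have p: "p < n * n" "translation_part n g $ p \<noteq> 0"
    using LeastI_ex[of ?P] by (auto simp: p_def)
  have zero: "translation_part n g $ m = 0" if "m < p" for m
    using not_less_Least[of m ?P] that p(1) by (auto simp: p_def)
  interpret group_action "pos_upper_triangular_group n" "carrier_vec (n * n)" "triangular_act n"
    by (rule group_action_act)
  show ?thesis
  proof (rule rigid_hyperbolic_if_leading_coordinate_shifted[OF _ p])
    show "bij_betw (triangular_act n g) (carrier_vec (n * n)) (carrier_vec (n * n))"
      using bij_prop0[OF g] by (simp add: Bij_def)
    show "triangular_act n g x $ m = x $ m" if "x \<in> carrier_vec (n * n)" "m < p" for x m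
      using act_index_if_translation_part_zero_below[OF g that(1), of m] zero that(2) p(1) by simp
    show "triangular_act n g x $ p = x $ p + translation_part n g $ p" if "x \<in> carrier_vec (n * n)" for x
      using act_index_if_translation_part_zero_below[OF g that p(1)] zero by simp
  qed
qed

theorem theorem0p3:
  fixes n :: nat
  assumes "n \<ge> 1"
  shows "\<exists>k \<phi>. essentially_free_affine_action (lex_group k) (pos_upper_triangular_group n) \<phi>"
proof -
  have "essentially_free_affine_action (lex_group (n * n)) (pos_upper_triangular_group n) (triangular_act n)"
    unfolding essentially_free_affine_action_def
    using affine_action_act rigid_hyperbolic_act by (simp add: pos_upper_triangular_group_simps(3))
  then show ?thesis by blast
qed

end
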